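(* (Constructive Comparison) Let $G,H\in\mathbb{GS}$. Then $G\succcurlyeq H$ if and only if all of the following hold: (1) $\underline{Ls}(G)\ge\underline{Ls}(H)$ and $\overline{Rs}(G)\ge\overline{Rs}(H)$; (2) for every Left option $H^L$ of $H$, either there is a Left option $G^L$ of $G$ with $G^L\succcurlyeq H^L$, or there is a Right option $H^{LR}$ of $H^L$ with $G\succcurlyeq H^{LR}$; (3) for every Right option $G^R$ of $G$, either there is a Right option $H^R$ of $H$ with $G^R\succcurlyeq H^R$, or there is a Left option $G^{RL}$ of $G^R$ with $G^{RL}\succcurlyeq H$.
   Context: A scoring game is written $G=\langle G^{\mathcal L}\mid G^{\mathcal R}\rangle$, where each of $G^{\mathcal L}$ (Left options) and $G^{\mathcal R}$ (Right options) is either a finite nonempty set of scoring games or an atom $\emptyset^{s}$, $s\in\mathbb R$ (the player to move on that side cannot move and the game ends with score $s$; an atom contributes no options); game trees are finite. An atom occurring in $G$ is an atom of $G$ or of any follower of $G$. $G$ is guaranteed if for every follower $K$ of $G$: if $K^{\mathcal L}=\emptyset^\ell$ then $\ell\le s$ for every atom $\emptyset^s$ occurring in $K$, and if $K^{\mathcal R}=\emptyset^r$ then $s\le r$ for every atom $\emptyset^s$ occurring in $K$; $\mathbb{GS}$ is the class of guaranteed games. Disjunctive sum $G+H$: Left options are $G^L+H$ and $G+H^L$, except if both are left-atomic with atoms $\emptyset^{\ell_1},\emptyset^{\ell_2}$, then $(G+H)^{\mathcal L}=\emptyset^{\ell_1+\ell_2}$; Right symmetric. Stops: $Ls(G)=\ell$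 if $G^{\mathcal L}=\emptyset^\ell$, otherwise $\max_{G^L}Rs(G^L)$; $Rs(G)=r$ if $G^{\mathcal R}=\emptyset^r$, otherwise $\min_{G^R}Ls(G^R)$. $G\succcurlyeq H$ iff $Ls(G+X)\ge Ls(H+X)$ and $Rs(G+X)\ge Rs(H+X)$ for all $X\in\mathbb{GS}$. Conjugate: $\overleftrightarrow{G}=\langle\overleftrightarrow{G^{\mathcal R}}\mid\overleftrightarrow{G^{\mathcal L}}\rangle$ (atom $\emptyset^s$ becomes $\emptyset^{-s}$). Waiting moves: $\widehat 0=\langle\emptyset^0\mid\emptyset^0\rangle$, $\widehat{k+1}=\langle\widehat k\mid\emptyset^0\rangle$, $-\widehat k=\overleftrightarrow{\widehat k}$. Pass-allowed stops: $\underline{Ls}(G)=\min_{k\ge0}Ls(G-\widehat k)$ and $\overline{Rs}(G)=\max_{k\ge0}Rs(G+\widehat k)$. *)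

theory Defs
  imports Complex_Main "HOL-Library.FSet"
begin

text \<open>
  The datatype also contains terms with an empty option set, which are not scoring games;
  they are excluded by \<open>scoring_game\<close> below.
\<close>

datatype sgame = SGame (lside: side) (rside: side)
  and side = Atom real | Opts "sgame fset"

primrec opts :: "side \<Rightarrow> sgame fset" where
  "opts (Atom s) = {||}"
| "opts (Opts A) = A"

abbreviation lopts :: "sgame \<Rightarrow> sgame fset" where "lopts G \<equiv> opts (lside G)"
abbreviation ropts :: "sgame \<Rightarrow> sgame fset" where "ropts G \<equiv> opts (rside G)"

lemma size_opts: "K |\<in>| opts S \<Longrightarrow> size K < size S"
proof (cases S)
  case (Opts A)
  assume "K |\<in>| opts S"
  then have "K \<in> fset A" using Opts by simp
  then have "Suc (size K) \<le> (\<Sum>x\<in>fset A. Suc (size x))"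
    by (rule member_le_sum) auto
  then show ?thesis using Opts by simp
qed simp

lemma size_lopts [termination_simp]: "K |\<in>| lopts G \<Longrightarrow> size K < size G"
  using size_opts[of K "lside G"] by (cases G) auto

lemma size_ropts [termination_simp]: "K |\<in>| ropts G \<Longrightarrow> size K < size G"
  using size_opts[of K "rside G"] by (cases G) auto

text \<open>Every game is a follower of itself.\<close>

inductive_set followers :: "sgame \<Rightarrow> sgame set" for G where
  self: "G \<in> followers G"
| left: "K \<in> followers G \<Longrightarrow> K' |\<in>| lopts K \<Longrightarrow> K' \<in> followers G"
| right: "K \<in> followers G \<Longrightarrow> K' |\<in>| ropts K \<Longrightarrow> K' \<in> followers G"

definition atoms :: "sgame \<Rightarrow> real set" where
  "atoms G = {s. \<exists>K\<in>followers G. lside K = Atom s \<or> rside K = Atom s}"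

definition scoring_game :: "sgame \<Rightarrow> bool" where
  "scoring_game G \<longleftrightarrow> (\<forall>K\<in>followers G. lside K \<noteq> Opts {||} \<and> rside K \<noteq> Opts {||})"

definition GS :: "sgame set" where
  "GS = {G. scoring_game G \<and>
    (\<forall>K\<in>followers G.
       (\<forall>l. lside K = Atom l \<longrightarrow> (\<forall>s\<in>atoms K. l \<le> s)) \<and>
       (\<forall>r. rside K = Atom r \<longrightarrow> (\<forall>s\<in>atoms K. s \<le> r)))}"

declare fset.map_cong [fundef_cong]

function gsum :: "sgame \<Rightarrow> sgame \<Rightarrow> sgame" (infixl "+\<^sub>g" 65) where
  "G +\<^sub>g H = SGame
     (case (lside G, lside H) of
        (Atom s, Atom t) \<Rightarrow> Atom (s + t)
      | _ \<Rightarrow> Opts ((\<lambda>G'. G' +\<^sub>g H) |`| lopts G |\<union>| (\<lambda>H'. G +\<^sub>g H') |`| lopts H))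
     (case (rside G, rside H) of
        (Atom s, Atom t) \<Rightarrow> Atom (s + t)
      | _ \<Rightarrow> Opts ((\<lambda>G'. G' +\<^sub>g H) |`| ropts G |\<union>| (\<lambda>H'. G +\<^sub>g H') |`| ropts H))"
  by auto
termination
  by (relation "measure (\<lambda>(G, H). size G + size H)") (auto simp: size_lopts size_ropts)

declare gsum.simps [simp del]

function conjugate :: "sgame \<Rightarrow> sgame" where
  "conjugate G = SGame
     (case rside G of Atom s \<Rightarrow> Atom (- s) | Opts _ \<Rightarrow> Opts (conjugate |`| ropts G))
     (case lside G of Atom s \<Rightarrow> Atom (- s) | Opts _ \<Rightarrow> Opts (conjugate |`| lopts G))"
  by auto
termination
  by (relation "measure size") (auto simp: size_lopts size_ropts)

declare conjugate.simps [simp del]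

function Ls :: "sgame \<Rightarrow> real" and Rs :: "sgame \<Rightarrow> real" where
  "Ls G = (case lside G of Atom s \<Rightarrow> s | Opts _ \<Rightarrow> Max (Rs ` fset (lopts G)))"
| "Rs G = (case rside G of Atom s \<Rightarrow> s | Opts _ \<Rightarrow> Min (Ls ` fset (ropts G)))"
  by pat_completeness auto
termination
  by (relation "measure (\<lambda>x. case x of Inl G \<Rightarrow> size G | Inr G \<Rightarrow> size G)")
    (auto simp: size_lopts size_ropts)

declare Ls.simps [simp del] Rs.simps [simp del]

definition game_ge :: "sgame \<Rightarrow> sgame \<Rightarrow> bool" (infix "\<succeq>" 50) where
  "G \<succeq> H \<longleftrightarrow> (\<forall>X\<in>GS. Ls (G +\<^sub>g X) \<ge> Ls (H +\<^sub>g X) \<and> Rs (G +\<^sub>g X) \<ge> Rs (H +\<^sub>g X))"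

primrec waiting :: "nat \<Rightarrow> sgame" where
  "waiting 0 = SGame (Atom 0) (Atom 0)"
| "waiting (Suc k) = SGame (Opts {|waiting k|}) (Atom 0)"

text \<open>
  The sets below are finite for every scoring game (lemmas \<open>finite_pass_Ls\<close> and
  \<open>finite_pass_Rs\<close>), so the minimum and the maximum are attained.
\<close>

definition pass_Ls :: "sgame \<Rightarrow> real" where
  "pass_Ls G = Min (range (\<lambda>k. Ls (G +\<^sub>g conjugate (waiting k))))"

definition pass_Rs :: "sgame \<Rightarrow> real" where
  "pass_Rs G = Max (range (\<lambda>k. Rs (G +\<^sub>g waiting k)))"

lemma followers_trans: "K \<in> followers G' \<Longrightarrow> G' \<in> followers G \<Longrightarrow> K \<in> followers G"
  by (induction rule: followers.induct) (auto intro: followers.intros)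

lemma followers_unfold:
  "followers G = insert G (\<Union>K\<in>fset (lopts G) \<union> fset (ropts G). followers K)" (is "_ = ?R")
proof
  have "K \<in> ?R" if "K \<in> followers G" for K
    using that
  proof (induction rule: followers.induct)
    case self
    show ?case by simp
  next
    case (left K K')
    then show ?case by (auto intro: followers.intros)
  next
    case (right K K')
    then show ?case by (auto intro: followers.intros)
  qed
  then show "followers G \<subseteq> ?R" by blast
  have "followers K \<subseteq> followers G" if "K |\<in>| lopts G \<or> K |\<in>| ropts G" for K
  proof -
    have "K \<in> followers G" using that followers.intros by blast
    then show ?thesis using followers_trans by blast
  qed
  then show "?R \<subseteq> followers G" using followers.self by blast
qed

lemma finite_followers: "finite (followers G)"
proof (induction "size G" arbitrary: G rule: less_induct)
  case less
  then show ?case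
    by (subst followers_unfold) (auto simp: size_lopts size_ropts)
qed

lemma finite_atoms: "finite (atoms G)"
proof -
  have "atoms G \<subseteq> (\<lambda>S. case S of Atom s \<Rightarrow> s | Opts _ \<Rightarrow> 0) ` (lside ` followers G \<union> rside ` followers G)"
    unfolding atoms_def by (force simp: image_iff)
  then show ?thesis
    using finite_followers by (meson finite_UnI finite_imageI finite_subset)
qed

lemma atoms_follower: "K \<in> followers G \<Longrightarrow> atoms K \<subseteq> atoms G"
  unfolding atoms_def using followers_trans by blast

lemma scoring_game_follower: "K \<in> followers G \<Longrightarrow> scoring_game G \<Longrightarrow> scoring_game K"
  unfolding scoring_game_def using followers_trans by blast

lemma stops_gsum_in_atoms:
  assumes "scoring_game G" "scoring_game H"
  shows "Ls (G +\<^sub>g H) \<in> (\<lambda>(s, t). s + t) ` (atoms G \<times> atoms H) \<and>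
         Rs (G +\<^sub>g H) \<in> (\<lambda>(s, t). s + t) ` (atoms G \<times> atoms H)"
  using assms
proof (induction "size G + size H" arbitrary: G H rule: less_induct)
  case less
  let ?A = "(\<lambda>(s, t). s + t) ` (atoms G \<times> atoms H)"
  have IH1: "Ls (K +\<^sub>g H) \<in> ?A \<and> Rs (K +\<^sub>g H) \<in> ?A"
    if K: "K |\<in>| lopts G \<or> K |\<in>| ropts G" for K
  proof -
    have f: "K \<in> followers G" using K by (auto intro: followers.intros)
    have "size K < size G" using K size_lopts size_ropts by blast
    then have "Ls (K +\<^sub>g H) \<in> (\<lambda>(s, t). s + t) ` (atoms K \<times> atoms H) \<and>
        Rs (K +\<^sub>g H) \<in> (\<lambda>(s, t). s + t) ` (atoms K \<times> atoms H)"
      using less scoring_game_follower[OF f] by simp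
    moreover have "(\<lambda>(s, t). s + t) ` (atoms K \<times> atoms H) \<subseteq> ?A"
      by (intro image_mono Sigma_mono atoms_follower f subset_refl)
    ultimately show ?thesis by blast
  qed
  have IH2: "Ls (G +\<^sub>g K) \<in> ?A \<and> Rs (G +\<^sub>g K) \<in> ?A"
    if K: "K |\<in>| lopts H \<or> K |\<in>| ropts H" for K
  proof -
    have f: "K \<in> followers H" using K by (auto intro: followers.intros)
    have "size K < size H" using K size_lopts size_ropts by blast
    then have "Ls (G +\<^sub>g K) \<in> (\<lambda>(s, t). s + t) ` (atoms G \<times> atoms K) \<and>
        Rs (G +\<^sub>g K) \<in> (\<lambda>(s, t). s + t) ` (atoms G \<times> atoms K)"
      using less scoring_game_follower[OF f] by simp
    moreover have "(\<lambda>(s, t). s + t) ` (atoms G \<times> atoms K) \<subseteq> ?A"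
      by (intro image_mono Sigma_mono atoms_follower f subset_refl)
    ultimately show ?thesis by blast
  qed
  have ne: "lside G \<noteq> Opts {||}" "rside G \<noteq> Opts {||}" "lside H \<noteq> Opts {||}" "rside H \<noteq> Opts {||}"
    using less.prems followers.self unfolding scoring_game_def by blast+
  have at: "lside G = Atom s \<or> rside G = Atom s \<Longrightarrow> s \<in> atoms G"
    "lside H = Atom s \<or> rside H = Atom s \<Longrightarrow> s \<in> atoms H" for s
    unfolding atoms_def using followers.self by blast+
  have "Ls (G +\<^sub>g H) \<in> ?A"
  proof (cases "\<exists>s t. lside G = Atom s \<and> lside H = Atom t")
    case True
    then obtain s t where st: "lside G = Atom s" "lside H = Atom t" by blast
    then have "lside (G +\<^sub>g H) = Atom (s + t)" by (subst gsum.simps) simp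
    then have "Ls (G +\<^sub>g H) = s + t" by (subst Ls.simps) simp
    moreover have "s \<in> atoms G" "t \<in> atoms H" using at st by blast+
    ultimately show ?thesis by (auto intro!: image_eqI[of _ _ "(s, t)"])
  next
    case False
    define S where "S = (\<lambda>K. K +\<^sub>g H) |`| lopts G |\<union>| (\<lambda>K. G +\<^sub>g K) |`| lopts H"
    have S: "lside (G +\<^sub>g H) = Opts S"
      using False by (subst gsum.simps) (auto simp: S_def split: side.splits)
    have "S \<noteq> {||}"
      using False ne by (cases "lside G"; cases "lside H") (auto simp: S_def)
    then have "Max (Rs ` fset S) \<in> Rs ` fset S" by (intro Max_in) auto
    moreover have "Rs K \<in> ?A" if "K |\<in>| S" for K
      using that IH1 IH2 unfolding S_def by blast
    moreover have "Ls (G +\<^sub>g H) = Max (Rs ` fset S)"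
      using S by (subst Ls.simps) simp
    ultimately show ?thesis by (metis imageE)
  qed
  moreover have "Rs (G +\<^sub>g H) \<in> ?A"
  proof (cases "\<exists>s t. rside G = Atom s \<and> rside H = Atom t")
    case True
    then obtain s t where st: "rside G = Atom s" "rside H = Atom t" by blast
    then have "rside (G +\<^sub>g H) = Atom (s + t)" by (subst gsum.simps) simp
    then have "Rs (G +\<^sub>g H) = s + t" by (subst Rs.simps) simp
    moreover have "s \<in> atoms G" "t \<in> atoms H" using at st by blast+
    ultimately show ?thesis by (auto intro!: image_eqI[of _ _ "(s, t)"])
  next
    case False
    define S where "S = (\<lambda>K. K +\<^sub>g H) |`| ropts G |\<union>| (\<lambda>K. G +\<^sub>g K) |`| ropts H"
    have S: "rside (G +\<^sub>g H) = Opts S"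
      using False by (subst gsum.simps) (auto simp: S_def split: side.splits)
    have "S \<noteq> {||}"
      using False ne by (cases "rside G"; cases "rside H") (auto simp: S_def)
    then have "Min (Ls ` fset S) \<in> Ls ` fset S" by (intro Min_in) auto
    moreover have "Ls K \<in> ?A" if "K |\<in>| S" for K
      using that IH1 IH2 unfolding S_def by blast
    moreover have "Rs (G +\<^sub>g H) = Min (Ls ` fset S)"
      using S by (subst Rs.simps) simp
    ultimately show ?thesis by (metis imageE)
  qed
  ultimately show ?case by blast
qed

lemma waiting_scoring: "scoring_game (waiting k) \<and> atoms (waiting k) = {0}"
proof (induction k)
  case 0
  then show ?case
    unfolding scoring_game_def atoms_def by (subst (1 2) followers_unfold) auto
next
  case (Suc k)
  have "followers (waiting (Suc k)) = insert (waiting (Suc k)) (followers (waiting k))"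
    by (subst followers_unfold) simp
  then have "scoring_game (waiting (Suc k)) \<longleftrightarrow> scoring_game (waiting k)"
    and "atoms (waiting (Suc k)) = insert 0 (atoms (waiting k))"
    unfolding scoring_game_def atoms_def by auto
  with Suc show ?case by simp
qed

lemma conjugate_waiting_scoring:
  "scoring_game (conjugate (waiting k)) \<and> atoms (conjugate (waiting k)) = {0}"
proof (induction k)
  case 0
  then show ?case
    unfolding scoring_game_def atoms_def
    by (subst (1 2) followers_unfold) (auto simp: conjugate.simps[of "SGame _ _"])
next
  case (Suc k)
  have c: "conjugate (waiting (Suc k)) = SGame (Atom 0) (Opts {|conjugate (waiting k)|})"
    by (simp add: conjugate.simps[of "SGame _ _"])
  then have "followers (conjugate (waiting (Suc k))) =
      insert (conjugate (waiting (Suc k))) (followers (conjugate (waiting k)))"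
    by (subst followers_unfold) simp
  then have "scoring_game (conjugate (waiting (Suc k))) \<longleftrightarrow> scoring_game (conjugate (waiting k))"
    and "atoms (conjugate (waiting (Suc k))) = insert 0 (atoms (conjugate (waiting k)))"
    unfolding scoring_game_def atoms_def c by auto
  with Suc show ?case by simp
qed

lemma finite_pass_Ls:
  assumes "scoring_game G"
  shows "finite (range (\<lambda>k. Ls (G +\<^sub>g conjugate (waiting k))))"
proof (rule finite_subset)
  show "range (\<lambda>k. Ls (G +\<^sub>g conjugate (waiting k))) \<subseteq> (\<lambda>(s, t). s + t) ` (atoms G \<times> {0})"
  proof (rule image_subsetI)
    fix k
    show "Ls (G +\<^sub>g conjugate (waiting k)) \<in> (\<lambda>(s, t). s + t) ` (atoms G \<times> {0})"
      using stops_gsum_in_atoms[OF assms, of "conjugate (waiting k)"] conjugate_waiting_scoring[of k] by simp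
  qed
qed (simp add: finite_atoms)

lemma finite_pass_Rs:
  assumes "scoring_game G"
  shows "finite (range (\<lambda>k. Rs (G +\<^sub>g waiting k)))"
proof (rule finite_subset)
  show "range (\<lambda>k. Rs (G +\<^sub>g waiting k)) \<subseteq> (\<lambda>(s, t). s + t) ` (atoms G \<times> {0})"
  proof (rule image_subsetI)
    fix k
    show "Rs (G +\<^sub>g waiting k) \<in> (\<lambda>(s, t). s + t) ` (atoms G \<times> {0})"
      using stops_gsum_in_atoms[OF assms, of "waiting k"] waiting_scoring[of k] by simp
  qed
qed (simp add: finite_atoms)

end

theory Submission imports Defs begin

text \<open>
  If no \<open>G\<^sup>L \<succeq> H\<close> and no \<open>H\<^sup>R\<close> satisfies \<open>G \<succeq> H\<^sup>R\<close>, then there is a guaranteed \<open>T\<close> with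
  \<open>Ls (G + T) < 0 < Rs (H + T)\<close>: its Right options separate the \<open>G\<^sup>L\<close> from \<open>H\<close>, its Left options
  separate \<open>G\<close> from the \<open>H\<^sup>R\<close>, so every move in \<open>G\<close> or \<open>H\<close> has an answer in \<open>T\<close>. A side of \<open>T\<close>
  that would be empty is replaced by an extreme atom. Applied to \<open>(G, H\<^sup>L)\<close> and to \<open>(G\<^sup>R, H)\<close>,
  this shows that the option conditions are necessary.

  Conversely, the inequalities between the stops of \<open>G + X\<close> and \<open>H + X\<close> follow by induction on
  \<open>X\<close>. The option conditions handle every move; if \<open>H\<close> and \<open>X\<close> are both left-atomic with atoms
  \<open>h\<close> and \<open>x\<close>, then \<open>pass_Ls H = h\<close>, and Left secures \<open>pass_Ls G + x\<close> in \<open>G + X\<close> by moving only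
  in \<open>G\<close>. The claims for Right are obtained by conjugation.
\<close>

section \<open>Options and stops of a sum\<close>

text \<open>The defining equation of \<open>+\<^sub>g\<close> applies again to the sums on its own
  right-hand side, so it is unsafe as a rewrite rule; projecting to one side unfolds just one
  level.\<close>

lemma lside_gsum: "lside (G +\<^sub>g H) =
    (case (lside G, lside H) of (Atom s, Atom t) \<Rightarrow> Atom (s + t)
     | _ \<Rightarrow> Opts ((\<lambda>G'. G' +\<^sub>g H) |`| lopts G |\<union>| (\<lambda>H'. G +\<^sub>g H') |`| lopts H))"
  by (subst gsum.simps) (simp only: sgame.sel)

lemma rside_gsum: "rside (G +\<^sub>g H) =
    (case (rside G, rside H) of (Atom s, Atom t) \<Rightarrow> Atom (s + t)
     | _ \<Rightarrow> Opts ((\<lambda>G'. G' +\<^sub>g H) |`| ropts G |\<union>| (\<lambda>H'. G +\<^sub>g H') |`| ropts H))"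
  by (subst gsum.simps) (simp only: sgame.sel)

lemma lopts_gsum:
  "lopts (G +\<^sub>g H) = (\<lambda>G'. G' +\<^sub>g H) |`| lopts G |\<union>| (\<lambda>H'. G +\<^sub>g H') |`| lopts H"
  by (auto simp: lside_gsum split: side.split)

lemma ropts_gsum:
  "ropts (G +\<^sub>g H) = (\<lambda>G'. G' +\<^sub>g H) |`| ropts G |\<union>| (\<lambda>H'. G +\<^sub>g H') |`| ropts H"
  by (auto simp: rside_gsum split: side.split)

lemma lside_gsum_eq_Atom_iff:
  "lside (G +\<^sub>g H) = Atom u \<longleftrightarrow> (\<exists>s t. lside G = Atom s \<and> lside H = Atom t \<and> u = s + t)"
  by (auto simp: lside_gsum split: side.split)

lemma rside_gsum_eq_Atom_iff:
  "rside (G +\<^sub>g H) = Atom u \<longleftrightarrow> (\<exists>s t. rside G = Atom s \<and> rside H = Atom t \<and> u = s + t)"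
  by (auto simp: rside_gsum split: side.split)

lemma gsum_assoc: "(G +\<^sub>g H) +\<^sub>g K = G +\<^sub>g (H +\<^sub>g K)"
proof (induction "size G + size H + size K" arbitrary: G H K rule: less_induct)
  case less
  have less_opts: "size K' < size K" if "K' |\<in>| lopts K \<or> K' |\<in>| ropts K" for K K'
    using that size_lopts size_ropts by blast
  have G: "(\<lambda>G'. (G' +\<^sub>g H) +\<^sub>g K) |`| A = (\<lambda>G'. G' +\<^sub>g (H +\<^sub>g K)) |`| A"
    if "A = lopts G \<or> A = ropts G" for A
    by (rule fset.map_cong[OF refl], rule less) (use that less_opts in auto)
  have H: "(\<lambda>H'. (G +\<^sub>g H') +\<^sub>g K) |`| A = (\<lambda>H'. G +\<^sub>g (H' +\<^sub>g K)) |`| A"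
    if "A = lopts H \<or> A = ropts H" for A
    by (rule fset.map_cong[OF refl], rule less) (use that less_opts in auto)
  have K: "(\<lambda>K'. (G +\<^sub>g H) +\<^sub>g K') |`| A = (\<lambda>K'. G +\<^sub>g (H +\<^sub>g K')) |`| A"
    if "A = lopts K \<or> A = ropts K" for A
    by (rule fset.map_cong[OF refl], rule less) (use that less_opts in auto)
  have l: "lopts ((G +\<^sub>g H) +\<^sub>g K) = lopts (G +\<^sub>g (H +\<^sub>g K))"
    by (simp only: lopts_gsum fimage_funion fset.map_comp comp_def funion_assoc G H K simp_thms)
  have r: "ropts ((G +\<^sub>g H) +\<^sub>g K) = ropts (G +\<^sub>g (H +\<^sub>g K))"
    by (simp only: ropts_gsum fimage_funion fset.map_comp comp_def funion_assoc G H K simp_thms)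
  \<comment> \<open>\<open>opts\<close> sends both \<open>Atom u\<close> and
    \<open>Opts {||}\<close> to the empty set, so equal option sets determine a side only together
    with its possible atom.\<close>
  have side_eqI: "S = T" if "opts S = opts T" "\<And>u. S = Atom u \<longleftrightarrow> T = Atom u" for S T
    using that(1) that(2)[of "case S of Atom u \<Rightarrow> u"] that(2)[of "case T of Atom u \<Rightarrow> u"]
    by (cases S; cases T) auto
  have "lside ((G +\<^sub>g H) +\<^sub>g K) = lside (G +\<^sub>g (H +\<^sub>g K))"
    by (rule side_eqI[OF l]) (auto simp: lside_gsum_eq_Atom_iff add.assoc)
  moreover have "rside ((G +\<^sub>g H) +\<^sub>g K) = rside (G +\<^sub>g (H +\<^sub>g K))"
    by (rule side_eqI[OF r]) (auto simp: rside_gsum_eq_Atom_iff add.assoc)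
  ultimately show ?case by (rule sgame.expand[OF conjI])
qed

section \<open>Stops as values of optimal first moves\<close>

lemma Ls_Atom: "lside G = Atom s \<Longrightarrow> Ls G = s"
  by (subst Ls.simps) simp

lemma Rs_Atom: "rside G = Atom s \<Longrightarrow> Rs G = s"
  by (subst Rs.simps) simp

lemma Rs_lopt_le_Ls: "K |\<in>| lopts G \<Longrightarrow> Rs K \<le> Ls G"
  by (subst Ls.simps) (auto split: side.split)

lemma Rs_le_Ls_ropt: "K |\<in>| ropts G \<Longrightarrow> Rs G \<le> Ls K"
  by (subst Rs.simps) (auto split: side.split)

lemma Ls_attained:
  assumes "lside G \<noteq> Opts {||}" "\<And>s. lside G \<noteq> Atom s"
  shows "\<exists>K. K |\<in>| lopts G \<and> Ls G = Rs K"
proof -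
  obtain A where A: "lside G = Opts A" "A \<noteq> {||}" using assms by (cases "lside G") auto
  then have "Max (Rs ` fset A) \<in> Rs ` fset A" by (intro Max_in) auto
  moreover have "Ls G = Max (Rs ` fset A)" using A by (subst Ls.simps) simp
  ultimately show ?thesis using A by auto
qed

lemma Rs_attained:
  assumes "rside G \<noteq> Opts {||}" "\<And>s. rside G \<noteq> Atom s"
  shows "\<exists>K. K |\<in>| ropts G \<and> Rs G = Ls K"
proof -
  obtain A where A: "rside G = Opts A" "A \<noteq> {||}" using assms by (cases "rside G") auto
  then have "Min (Ls ` fset A) \<in> Ls ` fset A" by (intro Min_in) auto
  moreover have "Rs G = Min (Ls ` fset A)" using A by (subst Rs.simps) simp
  ultimately show ?thesis using A by auto
qed

lemma scoring_game_side: "scoring_game G \<Longrightarrow> lside G \<noteq> Opts {||} \<and> rside G \<noteq> Opts {||}"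
  using followers.self unfolding scoring_game_def by blast

lemma Rs_gsum_lopt_left: "G' |\<in>| lopts G \<Longrightarrow> Rs (G' +\<^sub>g X) \<le> Ls (G +\<^sub>g X)"
  by (rule Rs_lopt_le_Ls) (auto simp: lopts_gsum)

lemma Rs_gsum_lopt_right: "X' |\<in>| lopts X \<Longrightarrow> Rs (G +\<^sub>g X') \<le> Ls (G +\<^sub>g X)"
  by (rule Rs_lopt_le_Ls) (auto simp: lopts_gsum)

lemma Ls_gsum_ropt_left: "G' |\<in>| ropts G \<Longrightarrow> Rs (G +\<^sub>g X) \<le> Ls (G' +\<^sub>g X)"
  by (rule Rs_le_Ls_ropt) (auto simp: ropts_gsum)

lemma Ls_gsum_ropt_right: "X' |\<in>| ropts X \<Longrightarrow> Rs (G +\<^sub>g X) \<le> Ls (G +\<^sub>g X')"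
  by (rule Rs_le_Ls_ropt) (auto simp: ropts_gsum)

text \<open>The case split behind the strategy arguments: when Left is to move, either play is over
  or an optimal move lies in exactly one named component.\<close>

lemma Ls_gsum_cases [consumes 2, case_names atoms left right]:
  assumes "scoring_game G" "scoring_game X"
  obtains s t where "lside G = Atom s" "lside X = Atom t" "Ls (G +\<^sub>g X) = s + t"
  | G' where "G' |\<in>| lopts G" "Ls (G +\<^sub>g X) = Rs (G' +\<^sub>g X)"
  | X' where "X' |\<in>| lopts X" "Ls (G +\<^sub>g X) = Rs (G +\<^sub>g X')"
proof (cases "\<exists>u. lside (G +\<^sub>g X) = Atom u")
  case True
  then show ?thesis using that(1) Ls_Atom lside_gsum_eq_Atom_iff by metis
next
  case False
  moreover have "lside (G +\<^sub>g X) \<noteq> Opts {||}"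
    using assms[THEN scoring_game_side] by (auto simp: lside_gsum split: side.splits)
  ultimately show ?thesis using Ls_attained[of "G +\<^sub>g X"] that(2,3) by (auto simp: lopts_gsum)
qed

lemma Rs_gsum_cases [consumes 2, case_names atoms left right]:
  assumes "scoring_game G" "scoring_game X"
  obtains s t where "rside G = Atom s" "rside X = Atom t" "Rs (G +\<^sub>g X) = s + t"
  | G' where "G' |\<in>| ropts G" "Rs (G +\<^sub>g X) = Ls (G' +\<^sub>g X)"
  | X' where "X' |\<in>| ropts X" "Rs (G +\<^sub>g X) = Ls (G +\<^sub>g X')"
proof (cases "\<exists>u. rside (G +\<^sub>g X) = Atom u")
  case True
  then show ?thesis using that(1) Rs_Atom rside_gsum_eq_Atom_iff by metis
next
  case False
  moreover have "rside (G +\<^sub>g X) \<noteq> Opts {||}"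
    using assms[THEN scoring_game_side] by (auto simp: rside_gsum split: side.splits)
  ultimately show ?thesis using Rs_attained[of "G +\<^sub>g X"] that(2,3) by (auto simp: ropts_gsum)
qed

section \<open>Closure properties of guaranteed games\<close>

lemma GS_scoring_game: "G \<in> GS \<Longrightarrow> scoring_game G"
  by (simp add: GS_def)

lemma GS_follower: "K \<in> followers G \<Longrightarrow> G \<in> GS \<Longrightarrow> K \<in> GS"
  unfolding GS_def using followers_trans scoring_game_follower by blast

lemma GS_lopts: "K |\<in>| lopts G \<Longrightarrow> G \<in> GS \<Longrightarrow> K \<in> GS"
  by (blast intro: GS_follower followers.intros)

lemma GS_ropts: "K |\<in>| ropts G \<Longrightarrow> G \<in> GS \<Longrightarrow> K \<in> GS"
  by (blast intro: GS_follower followers.intros)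

lemma atoms_lopts: "K |\<in>| lopts G \<Longrightarrow> atoms K \<subseteq> atoms G"
  by (blast intro: atoms_follower[THEN subsetD] followers.intros)

lemma atoms_ropts: "K |\<in>| ropts G \<Longrightarrow> atoms K \<subseteq> atoms G"
  by (blast intro: atoms_follower[THEN subsetD] followers.intros)

lemma Atom_in_atoms: "lside G = Atom s \<or> rside G = Atom s \<Longrightarrow> s \<in> atoms G"
  unfolding atoms_def using followers.self by blast

lemma GS_lside_le_atoms: "G \<in> GS \<Longrightarrow> lside G = Atom l \<Longrightarrow> s \<in> atoms G \<Longrightarrow> l \<le> s"
  unfolding GS_def using followers.self by blast

lemma GS_rside_ge_atoms: "G \<in> GS \<Longrightarrow> rside G = Atom r \<Longrightarrow> s \<in> atoms G \<Longrightarrow> s \<le> r"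
  unfolding GS_def using followers.self by blast

lemma atoms_unfold:
  "atoms G = {s. lside G = Atom s \<or> rside G = Atom s} \<union>
    (\<Union>K\<in>fset (lopts G) \<union> fset (ropts G). atoms K)"
  unfolding atoms_def by (subst followers_unfold) blast

text \<open>Every follower other than \<open>G\<close> lies below an option, and options are
  guaranteed already, so only the two sides of \<open>G\<close> itself remain to be checked.\<close>

lemma GS_intro:
  assumes "lside G \<noteq> Opts {||}" "rside G \<noteq> Opts {||}"
    and "\<And>K. K |\<in>| lopts G \<or> K |\<in>| ropts G \<Longrightarrow> K \<in> GS"
    and "\<And>l s. lside G = Atom l \<Longrightarrow> s \<in> atoms G \<Longrightarrow> l \<le> s"
    and "\<And>r s. rside G = Atom r \<Longrightarrow> s \<in> atoms G \<Longrightarrow> s \<le> r"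
  shows "G \<in> GS"
proof -
  have f: "K = G \<or> (\<exists>J\<in>GS. K \<in> followers J)" if "K \<in> followers G" for K
    using that followers_unfold[of G] assms(3) by auto
  have s: "scoring_game G"
    unfolding scoring_game_def
    using f assms(1,2) scoring_game_side GS_scoring_game GS_follower by metis
  show ?thesis
    unfolding GS_def mem_Collect_eq
    using s f assms(4,5) GS_follower GS_lside_le_atoms GS_rside_ge_atoms by metis
qed

section \<open>Followers and atoms of a sum\<close>

lemma followers_gsum: "followers (G +\<^sub>g H) \<subseteq> {A +\<^sub>g B |A B. A \<in> followers G \<and> B \<in> followers H}"
proof
  fix K assume "K \<in> followers (G +\<^sub>g H)"
  then show "K \<in> {A +\<^sub>g B |A B. A \<in> followers G \<and> B \<in> followers H}"
  proof (induction rule: followers.induct)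
    case self
    show ?case using followers.self by blast
  next
    case (left K K')
    then show ?case by (auto simp: lopts_gsum) (metis followers.left followers.right)+
  next
    case (right K K')
    then show ?case by (auto simp: ropts_gsum) (metis followers.left followers.right)+
  qed
qed

lemma scoring_game_gsum:
  assumes "scoring_game G" "scoring_game H"
  shows "scoring_game (G +\<^sub>g H)"
  unfolding scoring_game_def
proof
  fix K assume "K \<in> followers (G +\<^sub>g H)"
  then obtain A B where "K = A +\<^sub>g B" "A \<in> followers G" "B \<in> followers H"
    using followers_gsum by blast
  then show "lside K \<noteq> Opts {||} \<and> rside K \<noteq> Opts {||}"
    using assms[THEN scoring_game_follower[rotated], THEN scoring_game_side]
    by (auto simp: lside_gsum rside_gsum split: side.splits)
qed

lemma atoms_gsum: "u \<in> atoms (G +\<^sub>g H) \<Longrightarrow> \<exists>s\<in>atoms G. \<exists>t\<in>atoms H. u = s + t"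
proof -
  assume "u \<in> atoms (G +\<^sub>g H)"
  then obtain A B where "A \<in> followers G" "B \<in> followers H"
    "lside (A +\<^sub>g B) = Atom u \<or> rside (A +\<^sub>g B) = Atom u"
    unfolding atoms_def using followers_gsum by blast
  then show ?thesis
    unfolding lside_gsum_eq_Atom_iff rside_gsum_eq_Atom_iff atoms_def by blast
qed

text \<open>A follower of the sum is a sum of followers. If it is left-atomic, both summands are,
  and their atoms are least; so the sum of these atoms lies below every sum of atoms. Right is
  dual.\<close>

lemma GS_gsum:
  assumes "G \<in> GS" "H \<in> GS"
  shows "G +\<^sub>g H \<in> GS"
  unfolding GS_def
proof (intro CollectI conjI ballI)
  show "scoring_game (G +\<^sub>g H)" using assms by (simp add: GS_scoring_game scoring_game_gsum)
next
  fix K assume "K \<in> followers (G +\<^sub>g H)"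
  then obtain A B where K: "K = A +\<^sub>g B" "A \<in> followers G" "B \<in> followers H"
    using followers_gsum by blast
  then have AB: "A \<in> GS" "B \<in> GS" using assms GS_follower by auto
  show "\<forall>l. lside K = Atom l \<longrightarrow> (\<forall>s\<in>atoms K. l \<le> s)"
    using GS_lside_le_atoms[OF AB(1)] GS_lside_le_atoms[OF AB(2)] K(1)
    by (fastforce simp: lside_gsum_eq_Atom_iff dest!: atoms_gsum intro: add_mono)
  show "\<forall>r. rside K = Atom r \<longrightarrow> (\<forall>s\<in>atoms K. s \<le> r)"
    using GS_rside_ge_atoms[OF AB(1)] GS_rside_ge_atoms[OF AB(2)] K(1)
    by (fastforce simp: rside_gsum_eq_Atom_iff dest!: atoms_gsum intro: add_mono)
qed

section \<open>Adding a number\<close>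

definition num :: "real \<Rightarrow> sgame" where
  "num c = SGame (Atom c) (Atom c)"

lemma num_sel [simp]: "lside (num c) = Atom c" "rside (num c) = Atom c"
  by (simp_all add: num_def)

lemma atoms_num [simp]: "atoms (num c) = {c}"
  by (subst atoms_unfold) auto

lemma num_in_GS [simp]: "num c \<in> GS"
  by (rule GS_intro) auto

text \<open>Nobody can move in \<open>num c\<close>, so play is play in \<open>G\<close> and
  \<open>c\<close> is added at the end.\<close>

lemma stops_gsum_num:
  assumes "scoring_game G"
  shows "Ls (G +\<^sub>g num c) = Ls G + c \<and> Rs (G +\<^sub>g num c) = Rs G + c"
  using assms
proof (induction "size G" arbitrary: G rule: less_induct)
  case less
  have IH: "Ls (K +\<^sub>g num c) = Ls K + c \<and> Rs (K +\<^sub>g num c) = Rs K + c"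
    if "K |\<in>| lopts G \<or> K |\<in>| ropts G" for K
    using that less size_lopts size_ropts by (blast intro: scoring_game_follower followers.intros)
  note ne = scoring_game_side[OF less.prems]
  note sc = less.prems GS_scoring_game[OF num_in_GS[of c]]
  have "Ls (G +\<^sub>g num c) = Ls G + c"
  proof (cases "\<exists>s. lside G = Atom s")
    case True
    then show ?thesis by (metis Ls_Atom lside_gsum_eq_Atom_iff num_sel(1))
  next
    case False
    then obtain K where K: "K |\<in>| lopts G" "Ls G = Rs K" using Ls_attained ne by blast
    have "Ls G + c \<le> Ls (G +\<^sub>g num c)" using K IH Rs_gsum_lopt_left by metis
    moreover have "Ls (G +\<^sub>g num c) \<le> Ls G + c"
      using sc by (cases rule: Ls_gsum_cases) (use False IH Rs_lopt_le_Ls in auto)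
    ultimately show ?thesis by simp
  qed
  moreover have "Rs (G +\<^sub>g num c) = Rs G + c"
  proof (cases "\<exists>s. rside G = Atom s")
    case True
    then show ?thesis by (metis Rs_Atom rside_gsum_eq_Atom_iff num_sel(2))
  next
    case False
    then obtain K where K: "K |\<in>| ropts G" "Rs G = Ls K" using Rs_attained ne by blast
    have "Rs (G +\<^sub>g num c) \<le> Rs G + c" using K IH Ls_gsum_ropt_left by metis
    moreover have "Rs G + c \<le> Rs (G +\<^sub>g num c)"
      using sc by (cases rule: Rs_gsum_cases) (use False IH Rs_le_Ls_ropt in auto)
    ultimately show ?thesis by simp
  qed
  ultimately show ?case by simp
qed

section \<open>Conjugation\<close>

lemma lside_conjugate: "lside (conjugate G) =
    (case rside G of Atom s \<Rightarrow> Atom (- s) | Opts _ \<Rightarrow> Opts (conjugate |`| ropts G))"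
  by (subst conjugate.simps) (simp only: sgame.sel)

lemma rside_conjugate: "rside (conjugate G) =
    (case lside G of Atom s \<Rightarrow> Atom (- s) | Opts _ \<Rightarrow> Opts (conjugate |`| lopts G))"
  by (subst conjugate.simps) (simp only: sgame.sel)

lemma lopts_conjugate: "lopts (conjugate G) = conjugate |`| ropts G"
  by (simp add: lside_conjugate split: side.split)

lemma ropts_conjugate: "ropts (conjugate G) = conjugate |`| lopts G"
  by (simp add: rside_conjugate split: side.split)

lemma side_conjugate_eq_Atom_iff:
  "lside (conjugate G) = Atom s \<longleftrightarrow> rside G = Atom (- s)"
  "rside (conjugate G) = Atom s \<longleftrightarrow> lside G = Atom (- s)"
  by (auto simp: lside_conjugate rside_conjugate split: side.split)

lemma conjugate_conjugate [simp]: "conjugate (conjugate G) = G"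
proof (induction "size G" arbitrary: G rule: less_induct)
  case less
  then have "conjugate (conjugate K) = K" if "K |\<in>| lopts G \<or> K |\<in>| ropts G" for K
    using that size_lopts size_ropts by blast
  then have "(\<lambda>K. conjugate (conjugate K)) |`| lopts G = lopts G"
    "(\<lambda>K. conjugate (conjugate K)) |`| ropts G = ropts G"
    by (auto simp: fset.map_ident_strong)
  then have "lside (conjugate (conjugate G)) = lside G" "rside (conjugate (conjugate G)) = rside G"
    by (auto simp: lside_conjugate rside_conjugate fset.map_comp comp_def split: side.split)
  then show ?case by (simp add: sgame.expand)
qed

lemma conjugate_gsum: "conjugate (G +\<^sub>g H) = conjugate G +\<^sub>g conjugate H"
proof (induction "size G + size H" arbitrary: G H rule: less_induct)
  case less
  have G: "conjugate (K +\<^sub>g H) = conjugate K +\<^sub>g conjugate H" if "K |\<in>| lopts G \<or> K |\<in>| ropts G" for K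
    using that less[of K H] size_lopts size_ropts by fastforce
  have H: "conjugate (G +\<^sub>g K) = conjugate G +\<^sub>g conjugate K" if "K |\<in>| lopts H \<or> K |\<in>| ropts H" for K
    using that less[of G K] size_lopts size_ropts by fastforce
  have "lside (conjugate (G +\<^sub>g H)) = lside (conjugate G +\<^sub>g conjugate H)"
    using G H by (auto simp: lside_conjugate lside_gsum rside_gsum fset.map_comp fimage_funion
        split: side.split intro!: arg_cong2[of _ _ _ _ "(|\<union>|)"] fset.map_cong)
  moreover have "rside (conjugate (G +\<^sub>g H)) = rside (conjugate G +\<^sub>g conjugate H)"
    using G H by (auto simp: rside_conjugate lside_gsum rside_gsum fset.map_comp fimage_funion
        split: side.split intro!: arg_cong2[of _ _ _ _ "(|\<union>|)"] fset.map_cong)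
  ultimately show ?case by (rule sgame.expand[OF conjI])
qed

lemma atoms_conjugate: "atoms (conjugate G) = uminus ` atoms G"
proof (induction "size G" arbitrary: G rule: less_induct)
  case less
  then have IH: "atoms (conjugate K) = uminus ` atoms K" if "K |\<in>| lopts G \<or> K |\<in>| ropts G" for K
    using that size_lopts size_ropts by blast
  have "{s. lside (conjugate G) = Atom s \<or> rside (conjugate G) = Atom s} =
      uminus ` {s. lside G = Atom s \<or> rside G = Atom s}"
    by (force simp: side_conjugate_eq_Atom_iff image_iff)
  moreover have "(\<Union>K\<in>fset (lopts (conjugate G)) \<union> fset (ropts (conjugate G)). atoms K) =
      uminus ` (\<Union>K\<in>fset (lopts G) \<union> fset (ropts G). atoms K)"
    using IH by (auto simp: lopts_conjugate ropts_conjugate image_UN image_Un)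
  ultimately show ?case
    by (simp only: atoms_unfold[of "conjugate G"] atoms_unfold[of G] image_Un)
qed

lemma GS_conjugate: "G \<in> GS \<Longrightarrow> conjugate G \<in> GS"
proof (induction "size G" arbitrary: G rule: less_induct)
  case less
  show ?case
  proof (rule GS_intro)
    show "lside (conjugate G) \<noteq> Opts {||}" "rside (conjugate G) \<noteq> Opts {||}"
      using scoring_game_side[OF GS_scoring_game[OF less.prems]]
      by (auto simp: lside_conjugate rside_conjugate split: side.splits)
  next
    fix K assume "K |\<in>| lopts (conjugate G) \<or> K |\<in>| ropts (conjugate G)"
    then show "K \<in> GS"
      using less size_lopts size_ropts GS_lopts GS_ropts
      by (auto simp: lopts_conjugate ropts_conjugate)
  next
    fix l s assume "lside (conjugate G) = Atom l" "s \<in> atoms (conjugate G)"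
    then show "l \<le> s"
      using GS_rside_ge_atoms[OF less.prems, of "- l" "- s"]
      by (auto simp: side_conjugate_eq_Atom_iff atoms_conjugate)
  next
    fix r s assume "rside (conjugate G) = Atom r" "s \<in> atoms (conjugate G)"
    then show "s \<le> r"
      using GS_lside_le_atoms[OF less.prems, of "- r" "- s"]
      by (auto simp: side_conjugate_eq_Atom_iff atoms_conjugate)
  qed
qed

text \<open>Optimal moves on one side mirror optimal moves on the other, since negation exchanges
  maxima and minima.\<close>

lemma stops_conjugate:
  assumes "scoring_game G"
  shows "Ls (conjugate G) = - Rs G \<and> Rs (conjugate G) = - Ls G"
  using assms
proof (induction "size G" arbitrary: G rule: less_induct)
  case less
  have IH: "Ls (conjugate K) = - Rs K \<and> Rs (conjugate K) = - Ls K"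
    if "K |\<in>| lopts G \<or> K |\<in>| ropts G" for K
    using that less size_lopts size_ropts by (blast intro: scoring_game_follower followers.intros)
  note ne = scoring_game_side[OF less.prems]
  have "Ls (conjugate G) = - Rs G"
  proof (cases "rside G")
    case (Atom s)
    then show ?thesis by (simp add: Rs_Atom Ls_Atom side_conjugate_eq_Atom_iff)
  next
    case (Opts A)
    then have c: "lside (conjugate G) = Opts (conjugate |`| A)" by (simp add: lside_conjugate)
    obtain K where K: "K |\<in>| ropts G" "Rs G = Ls K" using Rs_attained Opts ne by fastforce
    obtain J where J: "J |\<in>| ropts G" "Ls (conjugate G) = Rs (conjugate J)"
      using Ls_attained[of "conjugate G"] Opts ne c by fastforce
    have "- Ls K \<le> Ls (conjugate G)"
      using Rs_lopt_le_Ls[of "conjugate K" "conjugate G"] K IH by (auto simp: lopts_conjugate)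
    then show ?thesis using K J IH Rs_le_Ls_ropt[OF J(1)] by auto
  qed
  moreover have "Rs (conjugate G) = - Ls G"
  proof (cases "lside G")
    case (Atom s)
    then show ?thesis by (simp add: Rs_Atom Ls_Atom side_conjugate_eq_Atom_iff)
  next
    case (Opts A)
    then have c: "rside (conjugate G) = Opts (conjugate |`| A)" by (simp add: rside_conjugate)
    obtain K where K: "K |\<in>| lopts G" "Ls G = Rs K" using Ls_attained Opts ne by fastforce
    obtain J where J: "J |\<in>| lopts G" "Rs (conjugate G) = Ls (conjugate J)"
      using Rs_attained[of "conjugate G"] Opts ne c by fastforce
    have "Rs (conjugate G) \<le> - Rs K"
      using Rs_le_Ls_ropt[of "conjugate K" "conjugate G"] K IH by (auto simp: ropts_conjugate)
    then show ?thesis using K J IH Rs_lopt_le_Ls[OF J(1)] by auto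
  qed
  ultimately show ?case by simp
qed

lemma stops_gsum_conjugate:
  assumes "G \<in> GS" "X \<in> GS"
  shows "Ls (conjugate G +\<^sub>g conjugate X) = - Rs (G +\<^sub>g X)"
    and "Rs (conjugate G +\<^sub>g conjugate X) = - Ls (G +\<^sub>g X)"
  using stops_conjugate[OF scoring_game_gsum[OF assms[THEN GS_scoring_game]]]
  by (simp_all add: conjugate_gsum)

text \<open>Testing the conjugates with \<open>X\<close> amounts to testing the originals with
  \<open>conjugate X\<close>; the stops change sign, which reverses the order.\<close>

lemma game_ge_conjugate:
  assumes "G \<in> GS" "H \<in> GS" "G \<succeq> H"
  shows "conjugate H \<succeq> conjugate G"
  unfolding game_ge_def
proof
  fix X assume X: "X \<in> GS"
  then show "Ls (conjugate G +\<^sub>g X) \<le> Ls (conjugate H +\<^sub>g X) \<and>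
      Rs (conjugate G +\<^sub>g X) \<le> Rs (conjugate H +\<^sub>g X)"
    using stops_gsum_conjugate[OF assms(1) GS_conjugate[OF X]]
      stops_gsum_conjugate[OF assms(2) GS_conjugate[OF X]] assms(3) GS_conjugate[OF X]
    unfolding game_ge_def by simp
qed

section \<open>Linked games\<close>

lemma ex_abs_bound:
  fixes A :: "real set"
  assumes "finite A"
  shows "\<exists>M>0. \<forall>s\<in>A. \<bar>s\<bar> < M"
proof (intro exI conjI ballI)
  \<comment> \<open>Inserting 0 keeps the maximum defined for empty \<open>A\<close> and makes the
    bound positive.\<close>
  have fin: "finite (insert 0 (abs ` A))" using assms by simp
  show "0 < Max (insert 0 (abs ` A)) + 1" using Max_ge[OF fin, of 0] by simp
  fix s assume "s \<in> A"
  then show "\<bar>s\<bar> < Max (insert 0 (abs ` A)) + 1" using Max_ge[OF fin, of "\<bar>s\<bar>"] by simp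
qed

lemma ex_Ls_separating_zero:
  assumes "G \<in> GS" "H \<in> GS" "X \<in> GS" "Ls (G +\<^sub>g X) < Ls (H +\<^sub>g X)"
  shows "\<exists>Y\<in>GS. Ls (G +\<^sub>g Y) < 0 \<and> 0 < Ls (H +\<^sub>g Y)"
proof -
  \<comment> \<open>Minus the midpoint of the two stops: the shift by \<open>c\<close> puts them on
    opposite sides of 0.\<close>
  define c where "c = - (Ls (G +\<^sub>g X) + Ls (H +\<^sub>g X)) / 2"
  have "Ls (K +\<^sub>g (X +\<^sub>g num c)) = Ls (K +\<^sub>g X) + c" if "K \<in> GS" for K
    using that assms(3) stops_gsum_num[of "K +\<^sub>g X" c]
    by (simp add: gsum_assoc[symmetric] GS_scoring_game GS_gsum)
  moreover have "Ls (G +\<^sub>g X) + c < 0" "0 < Ls (H +\<^sub>g X) + c"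
    using assms(4) by (simp_all add: c_def field_simps)
  ultimately have "Ls (G +\<^sub>g (X +\<^sub>g num c)) < 0 \<and> 0 < Ls (H +\<^sub>g (X +\<^sub>g num c))"
    using assms(1,2) by simp
  then show ?thesis using GS_gsum[OF assms(3) num_in_GS] by blast
qed

text \<open>
  The separating game \<open>\<langle>num M | X\<rangle>\<close> is so hot that a Right move outside it is answered by \<open>num M\<close>.
\<close>

lemma ex_Rs_separating_of_Ls:
  assumes "G \<in> GS" "H \<in> GS" "X \<in> GS" "Ls (G +\<^sub>g X) < 0" "0 < Ls (H +\<^sub>g X)"
  shows "\<exists>Y\<in>GS. Rs (G +\<^sub>g Y) < 0 \<and> 0 < Rs (H +\<^sub>g Y)"
proof -
  obtain M where M: "\<And>s. s \<in> atoms H \<Longrightarrow> \<bar>s\<bar> < M"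
    using ex_abs_bound[OF finite_atoms] by blast
  define Y where "Y = SGame (Opts {|num M|}) (Opts {|X|})"
  have Y: "Y \<in> GS" by (rule GS_intro) (use assms(3) in \<open>auto simp: Y_def\<close>)
  have "Rs (G +\<^sub>g Y) < 0"
    using Ls_gsum_ropt_right[of X Y G] assms(4) by (simp add: Y_def)
  moreover have "0 < Rs (H +\<^sub>g Y)"
    using GS_scoring_game[OF assms(2)] GS_scoring_game[OF Y]
  proof (cases rule: Rs_gsum_cases)
    case (atoms s t)
    then show ?thesis by (simp add: Y_def)
  next
    case (left K)
    have K: "scoring_game K" using left(1) assms(2) GS_ropts GS_scoring_game by blast
    \<comment> \<open>After Right's move to \<open>K\<close> and Left's reply to
      \<open>num M\<close>, the outcome is an atom of \<open>H\<close> plus \<open>M\<close>, which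
      is positive.\<close>
    have "Rs (K +\<^sub>g num M) \<in> (\<lambda>(s, t). s + t) ` (atoms K \<times> atoms (num M))"
      using stops_gsum_in_atoms[OF K GS_scoring_game[OF num_in_GS]] by blast
    then obtain s where "s \<in> atoms K" "Rs (K +\<^sub>g num M) = s + M" by auto
    moreover have "Rs (K +\<^sub>g num M) \<le> Ls (K +\<^sub>g Y)"
      by (rule Rs_gsum_lopt_right) (simp add: Y_def)
    ultimately show ?thesis using left M atoms_ropts by fastforce
  next
    case (right K)
    then show ?thesis using assms(5) by (simp add: Y_def)
  qed
  ultimately show ?thesis using Y by blast
qed

text \<open>Conjugation exchanges both the two games and the two stops, so a separation on one stop
  for the conjugates yields one on the other stop for \<open>G\<close> and \<open>H\<close>.\<close>

lemma separating_conjugate: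
  assumes "G \<in> GS" "H \<in> GS" "Y \<in> GS"
  shows "Ls (conjugate H +\<^sub>g conjugate Y) < 0 \<and> 0 < Ls (conjugate G +\<^sub>g conjugate Y) \<longleftrightarrow>
      Rs (G +\<^sub>g Y) < 0 \<and> 0 < Rs (H +\<^sub>g Y)"
    and "Rs (conjugate H +\<^sub>g conjugate Y) < 0 \<and> 0 < Rs (conjugate G +\<^sub>g conjugate Y) \<longleftrightarrow>
      Ls (G +\<^sub>g Y) < 0 \<and> 0 < Ls (H +\<^sub>g Y)"
  using stops_gsum_conjugate assms by auto

text \<open>Whichever stop witnesses the failure, both kinds of separation follow: a left-stop gap
  is shifted to 0 and then passed to right stops by a hot game. A right-stop gap becomes a left-stop
  gap under conjugation.\<close>

lemma not_game_ge_separating: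
  assumes GH: "G \<in> GS" "H \<in> GS" and "\<not> G \<succeq> H"
  shows "\<exists>X\<in>GS. Ls (G +\<^sub>g X) < 0 \<and> 0 < Ls (H +\<^sub>g X)"
    and "\<exists>Y\<in>GS. Rs (G +\<^sub>g Y) < 0 \<and> 0 < Rs (H +\<^sub>g Y)"
proof -
  note c = GH[THEN GS_conjugate]
  obtain X where X: "X \<in> GS" "Ls (G +\<^sub>g X) < Ls (H +\<^sub>g X) \<or> Rs (G +\<^sub>g X) < Rs (H +\<^sub>g X)"
    using assms(3) unfolding game_ge_def by force
  have "(\<exists>X\<in>GS. Ls (G +\<^sub>g X) < 0 \<and> 0 < Ls (H +\<^sub>g X)) \<and>
      (\<exists>Y\<in>GS. Rs (G +\<^sub>g Y) < 0 \<and> 0 < Rs (H +\<^sub>g Y))"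
    using X(2)
  proof
    assume "Ls (G +\<^sub>g X) < Ls (H +\<^sub>g X)"
    then show ?thesis using ex_Ls_separating_zero ex_Rs_separating_of_Ls GH X(1) by meson
  next
    assume "Rs (G +\<^sub>g X) < Rs (H +\<^sub>g X)"
    then have "Ls (conjugate H +\<^sub>g conjugate X) < Ls (conjugate G +\<^sub>g conjugate X)"
      using stops_gsum_conjugate GH X(1) by simp
    then obtain Y where Y: "Y \<in> GS" "Ls (conjugate H +\<^sub>g Y) < 0" "0 < Ls (conjugate G +\<^sub>g Y)"
      using ex_Ls_separating_zero[OF c(2,1)] X(1) GS_conjugate by blast
    then obtain Z where Z: "Z \<in> GS" "Rs (conjugate H +\<^sub>g Z) < 0" "0 < Rs (conjugate G +\<^sub>g Z)"
      using ex_Rs_separating_of_Ls[OF c(2,1)] by blast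
    show ?thesis
      using separating_conjugate[OF GH GS_conjugate[OF Y(1)]]
        separating_conjugate[OF GH GS_conjugate[OF Z(1)]] Y Z GS_conjugate by auto
  qed
  then show "\<exists>X\<in>GS. Ls (G +\<^sub>g X) < 0 \<and> 0 < Ls (H +\<^sub>g X)"
    "\<exists>Y\<in>GS. Rs (G +\<^sub>g Y) < 0 \<and> 0 < Rs (H +\<^sub>g Y)" by auto
qed

lemma ex_linking_game:
  assumes GH: "G \<in> GS" "H \<in> GS"
    and GL: "\<And>GL. GL |\<in>| lopts G \<Longrightarrow> \<not> GL \<succeq> H"
    and HR: "\<And>HR. HR |\<in>| ropts H \<Longrightarrow> \<not> G \<succeq> HR"
  shows "\<exists>T\<in>GS. Ls (G +\<^sub>g T) < 0 \<and> 0 < Rs (H +\<^sub>g T)"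
proof -
  have "\<forall>K. K |\<in>| lopts G \<longrightarrow> (\<exists>X\<in>GS. Ls (K +\<^sub>g X) < 0 \<and> 0 < Ls (H +\<^sub>g X))"
    using not_game_ge_separating(1) GH GL GS_lopts by blast
  then obtain X where X: "\<And>K. K |\<in>| lopts G \<Longrightarrow> X K \<in> GS \<and> Ls (K +\<^sub>g X K) < 0 \<and> 0 < Ls (H +\<^sub>g X K)"
    by metis
  have "\<forall>K. K |\<in>| ropts H \<longrightarrow> (\<exists>Y\<in>GS. Rs (G +\<^sub>g Y) < 0 \<and> 0 < Rs (K +\<^sub>g Y))"
    using not_game_ge_separating(2) GH HR GS_ropts by blast
  then obtain Y where Y: "\<And>K. K |\<in>| ropts H \<Longrightarrow> Y K \<in> GS \<and> Rs (G +\<^sub>g Y K) < 0 \<and> 0 < Rs (K +\<^sub>g Y K)"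
    by metis
  \<comment> \<open>All atoms that can occur in \<open>G\<close>, \<open>H\<close> or the separating
    games; the strict bound \<open>M\<close> must beat each of them.\<close>
  define A where "A = atoms G \<union> atoms H \<union> (\<Union>K\<in>fset (lopts G). atoms (X K)) \<union>
    (\<Union>K\<in>fset (ropts H). atoms (Y K))"
  have "finite A" by (simp add: A_def finite_atoms)
  then obtain M where M: "M > 0" "\<And>s. s \<in> A \<Longrightarrow> \<bar>s\<bar> < M"
    using ex_abs_bound by meson
  \<comment> \<open>The substitute atoms \<open>- M\<close> and \<open>M\<close> are extreme among
    the atoms of \<open>T\<close>, so \<open>T\<close> is guaranteed. They also outweigh any atom of
    \<open>G\<close> or \<open>H\<close>, which fixes the sign if play stops at once.\<close>
  define T where "T = SGame
    (if ropts H = {||} then Atom (- M) else Opts (Y |`| ropts H))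
    (if lopts G = {||} then Atom M else Opts (X |`| lopts G))"
  have l: "lopts T = Y |`| ropts H" and r: "ropts T = X |`| lopts G"
    by (simp_all add: T_def)
  have "atoms T \<subseteq> insert M (insert (- M) A)"
    by (subst atoms_unfold) (auto simp: l r A_def T_def split: if_splits)
  then have bound: "- M \<le> s \<and> s \<le> M" if "s \<in> atoms T" for s
    using that M by fastforce
  have T: "T \<in> GS"
  proof (rule GS_intro)
    show "lside T \<noteq> Opts {||}" "rside T \<noteq> Opts {||}" by (auto simp: T_def)
    show "K \<in> GS" if "K |\<in>| lopts T \<or> K |\<in>| ropts T" for K
      using that X Y by (auto simp: l r)
    show "k \<le> s" if "lside T = Atom k" "s \<in> atoms T" for k s
      using that bound[of s] by (auto simp: T_def split: if_splits)
    show "s \<le> k" if "rside T = Atom k" "s \<in> atoms T" for k s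
      using that bound[of s] by (auto simp: T_def split: if_splits)
  qed
  have "Ls (G +\<^sub>g T) < 0"
    using GS_scoring_game[OF GH(1)] GS_scoring_game[OF T]
  proof (cases rule: Ls_gsum_cases)
    case (atoms s t)
    then have "s \<in> A" using Atom_in_atoms by (auto simp: A_def)
    then show ?thesis using atoms M(2)[of s] by (auto simp: T_def split: if_splits)
  next
    case (left K)
    \<comment> \<open>Right answers the move to \<open>K\<close> by moving from \<open>T\<close> to
      \<open>X K\<close>.\<close>
    then show ?thesis using Ls_gsum_ropt_right[of "X K" T K] X by (fastforce simp: r)
  next
    case (right K)
    then show ?thesis using Y by (auto simp: l)
  qed
  moreover have "0 < Rs (H +\<^sub>g T)"
    using GS_scoring_game[OF GH(2)] GS_scoring_game[OF T]
  proof (cases rule: Rs_gsum_cases)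
    case (atoms s t)
    then have "s \<in> A" using Atom_in_atoms by (auto simp: A_def)
    then show ?thesis using atoms M(2)[of s] by (auto simp: T_def split: if_splits)
  next
    case (left K)
    \<comment> \<open>Left answers the move to \<open>K\<close> by moving from \<open>T\<close> to
      \<open>Y K\<close>.\<close>
    then show ?thesis using Rs_gsum_lopt_right[of "Y K" T K] Y by (fastforce simp: l)
  next
    case (right K)
    then show ?thesis using X by (auto simp: r)
  qed
  ultimately show ?thesis using T by blast
qed

section \<open>Pass-allowed stops\<close>

lemma lside_conjugate_waiting [simp]: "lside (conjugate (waiting k)) = Atom 0"
  by (cases k) (simp_all add: side_conjugate_eq_Atom_iff)

lemma waiting_in_GS [simp]: "waiting k \<in> GS"
proof (induction k)
  case 0
  then show ?case using num_in_GS[of 0] by (simp add: num_def)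
next
  case (Suc k)
  show ?case
    by (rule GS_intro) (use Suc waiting_scoring[of "Suc k"] in auto)
qed

lemma pass_Ls_le: "scoring_game G \<Longrightarrow> pass_Ls G \<le> Ls (G +\<^sub>g conjugate (waiting k))"
  unfolding pass_Ls_def by (rule Min_le) (auto simp: finite_pass_Ls)

lemma pass_Ls_attained:
  "scoring_game G \<Longrightarrow> \<exists>k. pass_Ls G = Ls (G +\<^sub>g conjugate (waiting k))"
  unfolding pass_Ls_def using Min_in[OF finite_pass_Ls] by fastforce

text \<open>Conjugation matches the two families of stops index by index with opposite signs, so the
  maximum of one is minus the minimum of the other.\<close>

lemma pass_Rs_conjugate:
  assumes "G \<in> GS"
  shows "pass_Rs G = - pass_Ls (conjugate G)"
proof -
  have *: "Rs (G +\<^sub>g waiting k) = - Ls (conjugate G +\<^sub>g conjugate (waiting k))" for k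
    using stops_gsum_conjugate(1)[OF assms waiting_in_GS] by simp
  have sc: "scoring_game (conjugate G)" using assms GS_conjugate GS_scoring_game by blast
  show ?thesis
    unfolding pass_Rs_def
  proof (rule Max_eqI)
    show "finite (range (\<lambda>k. Rs (G +\<^sub>g waiting k)))"
      using finite_pass_Rs assms GS_scoring_game by blast
    show "y \<le> - pass_Ls (conjugate G)" if "y \<in> range (\<lambda>k. Rs (G +\<^sub>g waiting k))" for y
      using that pass_Ls_le[OF sc] by (auto simp: *)
    show "- pass_Ls (conjugate G) \<in> range (\<lambda>k. Rs (G +\<^sub>g waiting k))"
      using pass_Ls_attained[OF sc] by (auto simp: *)
  qed
qed

text \<open>Left has no move in \<open>conjugate (waiting k)\<close> either, so play ends at once
  for every \<open>k\<close>.\<close>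

lemma pass_Ls_left_atomic:
  assumes "scoring_game G" "lside G = Atom s"
  shows "pass_Ls G = s"
proof -
  have "Ls (G +\<^sub>g conjugate (waiting k)) = s" for k
    using assms(2) by (intro Ls_Atom) (simp add: lside_gsum_eq_Atom_iff)
  then show ?thesis using pass_Ls_attained[OF assms(1)] by auto
qed

text \<open>
  Left ignores \<open>X\<close>: a Right move in \<open>X\<close> is treated as a pass, and when Left runs out of moves
  in \<open>G\<close> every remaining atom is at least as good for her, since \<open>G\<close> is guaranteed.
\<close>

lemma stops_gsum_ge_waiting:
  assumes "G \<in> GS" "scoring_game X" "\<forall>s\<in>atoms X. x \<le> s" "size X \<le> k"
  shows "Ls (G +\<^sub>g conjugate (waiting k)) + x \<le> Ls (G +\<^sub>g X) \<and>
    Rs (G +\<^sub>g conjugate (waiting k)) + x \<le> Rs (G +\<^sub>g X)"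
  using assms
proof (induction "size G + size X" arbitrary: G X k rule: less_induct)
  case less
  let ?W = "\<lambda>k. conjugate (waiting k)"
  note sG = GS_scoring_game[OF less.prems(1)] and sX = less.prems(2)
  have IHG: "Ls (K +\<^sub>g ?W k) + x \<le> Ls (K +\<^sub>g X) \<and> Rs (K +\<^sub>g ?W k) + x \<le> Rs (K +\<^sub>g X)"
    if "K |\<in>| lopts G \<or> K |\<in>| ropts G" for K
    using that less.hyps[of K X k] less.prems size_lopts size_ropts GS_lopts GS_ropts by fastforce
  have sW: "scoring_game (?W k)" using conjugate_waiting_scoring by blast
  have "Ls (G +\<^sub>g ?W k) + x \<le> Ls (G +\<^sub>g X)"
    using sG sW
  proof (cases rule: Ls_gsum_cases)
    case (atoms s t)
    \<comment> \<open>\<open>G\<close> is left-atomic and guaranteed, so \<open>s\<close> is its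
      least atom; the actual outcome is an atom of \<open>G\<close> plus an atom of
      \<open>X\<close>, hence at least \<open>s + x\<close>.\<close>
    then have "t = 0" by simp
    moreover obtain a b where "a \<in> Defs.atoms G" "b \<in> Defs.atoms X" "Ls (G +\<^sub>g X) = a + b"
      using stops_gsum_in_atoms[OF sG sX] by auto
    ultimately show ?thesis
      using atoms less.prems(3) GS_lside_le_atoms[OF less.prems(1)] by (simp add: add_mono)
  next
    case (left K)
    then show ?thesis using IHG[of K] Rs_gsum_lopt_left[of K G X] by simp
  next
    case (right K)
    then show ?thesis by simp
  qed
  moreover have "Rs (G +\<^sub>g ?W k) + x \<le> Rs (G +\<^sub>g X)"
    using sG sX
  proof (cases rule: Rs_gsum_cases)
    case (atoms s t)
    \<comment> \<open>Here \<open>G\<close> is right-atomic, so \<open>s\<close> is its greatest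
      atom and bounds whatever outcome play with waiting moves reaches.\<close>
    have "Rs (G +\<^sub>g ?W k) \<in> Defs.atoms G"
      using stops_gsum_in_atoms[OF sG sW] conjugate_waiting_scoring[of k] by auto
    then have "Rs (G +\<^sub>g ?W k) \<le> s" using GS_rside_ge_atoms less.prems(1) atoms by blast
    moreover have "x \<le> t" using atoms Atom_in_atoms less.prems(3) by blast
    ultimately show ?thesis using atoms by simp
  next
    case (left K)
    then show ?thesis using IHG[of K] Ls_gsum_ropt_left[of K G "?W k"] by simp
  next
    case (right K)
    \<comment> \<open>A move in \<open>X\<close> is paid for with one waiting move. The size of
      \<open>X\<close> drops by at least one, so the remaining \<open>j\<close> passes still suffice
      for \<open>K\<close>.\<close>
    have "size K < size X" using right(1) size_ropts by blast
    with less.prems(4) obtain j where j: "k = Suc j" "size K \<le> j" by (cases k) auto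
    have "scoring_game K" using right(1) sX by (blast intro: scoring_game_follower followers.intros)
    then have "Ls (G +\<^sub>g ?W j) + x \<le> Ls (G +\<^sub>g K)"
      using less.hyps[of G K j] less.prems atoms_ropts[OF right(1)] \<open>size K < size X\<close> j by auto
    moreover have "Rs (G +\<^sub>g ?W k) \<le> Ls (G +\<^sub>g ?W j)"
      unfolding j(1) by (rule Ls_gsum_ropt_right) (simp add: ropts_conjugate)
    ultimately show ?thesis using right(2) by simp
  qed
  ultimately show ?case by simp
qed

text \<open>\<open>X\<close> is guaranteed, so \<open>x\<close> is its least atom, and
  \<open>size X\<close> waiting moves are enough to imitate Right's moves there.\<close>

lemma pass_Ls_add_le:
  assumes "G \<in> GS" "X \<in> GS" "lside X = Atom x"
  shows "pass_Ls G + x \<le> Ls (G +\<^sub>g X)"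
  using stops_gsum_ge_waiting[OF assms(1), of X x "size X"] assms GS_lside_le_atoms GS_scoring_game
    pass_Ls_le[of G "size X"] by force

section \<open>Constructive comparison\<close>

text \<open>Left's optimal first move in \<open>H +\<^sub>g X\<close> is matched in
  \<open>G +\<^sub>g X\<close>: a move in \<open>X\<close> is copied, a move in \<open>H\<close> is
  handled by the option condition, and a finished game by the pass-allowed stops.\<close>

lemma Ls_gsum_mono_step:
  assumes GH: "G \<in> GS" "H \<in> GS" and X: "X \<in> GS"
    and pass: "pass_Ls H \<le> pass_Ls G"
    and HL: "\<And>HL. HL |\<in>| lopts H \<Longrightarrow>
      (\<exists>GL. GL |\<in>| lopts G \<and> GL \<succeq> HL) \<or> (\<exists>HLR. HLR |\<in>| ropts HL \<and> G \<succeq> HLR)"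
    and IH: "\<And>K. K |\<in>| lopts X \<Longrightarrow> Rs (H +\<^sub>g K) \<le> Rs (G +\<^sub>g K)"
  shows "Ls (H +\<^sub>g X) \<le> Ls (G +\<^sub>g X)"
  using GH(2)[THEN GS_scoring_game] X[THEN GS_scoring_game]
proof (cases rule: Ls_gsum_cases)
  case (atoms s t)
  then show ?thesis
    using pass_Ls_add_le[OF GH(1) X] pass_Ls_left_atomic[OF GS_scoring_game[OF GH(2)]] pass by force
next
  case (left K)
  from HL[OF left(1)] show ?thesis
  proof (elim disjE exE conjE)
    fix GL assume GL: "GL |\<in>| lopts G" "GL \<succeq> K"
    then have "Rs (K +\<^sub>g X) \<le> Rs (GL +\<^sub>g X)" using X unfolding game_ge_def by blast
    then show ?thesis using left Rs_gsum_lopt_left[OF GL(1), of X] by simp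
  next
    \<comment> \<open>Left's move to \<open>K\<close> is reversible: Right may reply to
      \<open>J\<close>, and \<open>G\<close> is already at least as good as \<open>J\<close>, so no
      move in \<open>G\<close> is required.\<close>
    fix J assume J: "J |\<in>| ropts K" "G \<succeq> J"
    then have "Ls (J +\<^sub>g X) \<le> Ls (G +\<^sub>g X)" using X unfolding game_ge_def by blast
    then show ?thesis using left Ls_gsum_ropt_left[OF J(1), of X] by simp
  qed
next
  case (right K)
  then show ?thesis using IH[of K] Rs_gsum_lopt_right[of K X G] by simp
qed

text \<open>The left-stop step for the conjugates, with \<open>conjugate H\<close> now the larger
  game; the condition on Right options of \<open>G\<close> becomes the one on Left options of
  \<open>conjugate G\<close>.\<close>

lemma Rs_gsum_mono_step:
  assumes GH: "G \<in> GS" "H \<in> GS" and X: "X \<in> GS"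
    and pass: "pass_Rs H \<le> pass_Rs G"
    and GR: "\<And>GR. GR |\<in>| ropts G \<Longrightarrow>
      (\<exists>HR. HR |\<in>| ropts H \<and> GR \<succeq> HR) \<or> (\<exists>GRL. GRL |\<in>| lopts GR \<and> GRL \<succeq> H)"
    and IH: "\<And>K. K |\<in>| ropts X \<Longrightarrow> Ls (H +\<^sub>g K) \<le> Ls (G +\<^sub>g K)"
  shows "Rs (H +\<^sub>g X) \<le> Rs (G +\<^sub>g X)"
proof -
  have "Ls (conjugate G +\<^sub>g conjugate X) \<le> Ls (conjugate H +\<^sub>g conjugate X)"
  proof (rule Ls_gsum_mono_step)
    show "conjugate H \<in> GS" "conjugate G \<in> GS" "conjugate X \<in> GS" using GH X GS_conjugate by auto
    show "pass_Ls (conjugate G) \<le> pass_Ls (conjugate H)"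
      using pass GH by (simp add: pass_Rs_conjugate)
  next
    fix K' assume "K' |\<in>| lopts (conjugate G)"
    then obtain K where K: "K |\<in>| ropts G" "K' = conjugate K" by (auto simp: lopts_conjugate)
    have KGS: "K \<in> GS" using K(1) GH(1) GS_ropts by blast
    from GR[OF K(1)]
    show "(\<exists>L. L |\<in>| lopts (conjugate H) \<and> L \<succeq> K') \<or> (\<exists>J. J |\<in>| ropts K' \<and> conjugate H \<succeq> J)"
    proof (elim disjE exE conjE)
      fix L assume "L |\<in>| ropts H" "K \<succeq> L"
      then show ?thesis
        using game_ge_conjugate[OF KGS] GH(2) GS_ropts K(2) by (auto simp: lopts_conjugate)
    next
      fix L assume "L |\<in>| lopts K" "L \<succeq> H"
      then show ?thesis
        using game_ge_conjugate[OF GS_lopts[OF _ KGS] GH(2)] K(2) by (auto simp: ropts_conjugate)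
    qed
  next
    fix K' assume "K' |\<in>| lopts (conjugate X)"
    then obtain K where K: "K |\<in>| ropts X" "K' = conjugate K" by (auto simp: lopts_conjugate)
    then show "Rs (conjugate G +\<^sub>g K') \<le> Rs (conjugate H +\<^sub>g K')"
      using IH[OF K(1)] stops_gsum_conjugate(2) GH GS_ropts[OF K(1) X] by simp
  qed
  then show ?thesis using stops_gsum_conjugate(1) GH X by simp
qed

text \<open>The game \<open>conjugate (waiting k)\<close> is an admissible test game; the
  \<open>k\<close> attaining the minimum for \<open>G\<close> bounds the minimum for
  \<open>H\<close> as well.\<close>

lemma game_ge_pass_Ls:
  assumes "scoring_game G" "scoring_game H" "G \<succeq> H"
  shows "pass_Ls H \<le> pass_Ls G"
proof -
  obtain k where k: "pass_Ls G = Ls (G +\<^sub>g conjugate (waiting k))"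
    using pass_Ls_attained assms(1) by blast
  have "pass_Ls H \<le> Ls (H +\<^sub>g conjugate (waiting k))" by (rule pass_Ls_le[OF assms(2)])
  also have "\<dots> \<le> pass_Ls G"
    using assms(3) GS_conjugate[OF waiting_in_GS] unfolding game_ge_def k by blast
  finally show ?thesis .
qed

theorem theorem41:
  fixes G H :: sgame
  assumes "G \<in> GS" and "H \<in> GS"
  shows "G \<succeq> H \<longleftrightarrow>
    (pass_Ls G \<ge> pass_Ls H \<and> pass_Rs G \<ge> pass_Rs H) \<and>
    (\<forall>HL. HL |\<in>| lopts H \<longrightarrow>
       (\<exists>GL. GL |\<in>| lopts G \<and> GL \<succeq> HL) \<or> (\<exists>HLR. HLR |\<in>| ropts HL \<and> G \<succeq> HLR)) \<and>
    (\<forall>GR. GR |\<in>| ropts G \<longrightarrow>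
       (\<exists>HR. HR |\<in>| ropts H \<and> GR \<succeq> HR) \<or> (\<exists>GRL. GRL |\<in>| lopts GR \<and> GRL \<succeq> H))"
    (is "_ \<longleftrightarrow> ?pass \<and> ?left \<and> ?right")
proof
  assume ge: "G \<succeq> H"
  have "pass_Ls (conjugate G) \<le> pass_Ls (conjugate H)"
    using game_ge_pass_Ls game_ge_conjugate[OF assms ge] assms GS_conjugate GS_scoring_game by blast
  then have ?pass
    using game_ge_pass_Ls[OF _ _ ge] assms GS_scoring_game by (simp add: pass_Rs_conjugate)
  moreover have ?left
  proof (intro allI impI, rule ccontr)
    fix K assume K: "K |\<in>| lopts H"
      and "\<not> ((\<exists>GL. GL |\<in>| lopts G \<and> GL \<succeq> K) \<or> (\<exists>HLR. HLR |\<in>| ropts K \<and> G \<succeq> HLR))"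
    then obtain T where T: "T \<in> GS" "Ls (G +\<^sub>g T) < 0" "0 < Rs (K +\<^sub>g T)"
      using ex_linking_game[OF assms(1) GS_lopts[OF K assms(2)]] by blast
    \<comment> \<open>Moving to \<open>K\<close> gives \<open>Ls (H +\<^sub>g T) > 0\<close>, while
      \<open>Ls (G +\<^sub>g T) < 0\<close>.\<close>
    then show False using ge Rs_gsum_lopt_left[OF K, of T] unfolding game_ge_def by force
  qed
  moreover have ?right
  proof (intro allI impI, rule ccontr)
    fix K assume K: "K |\<in>| ropts G"
      and "\<not> ((\<exists>HR. HR |\<in>| ropts H \<and> K \<succeq> HR) \<or> (\<exists>GRL. GRL |\<in>| lopts K \<and> GRL \<succeq> H))"
    then obtain T where T: "T \<in> GS" "Ls (K +\<^sub>g T) < 0" "0 < Rs (H +\<^sub>g T)"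
      using ex_linking_game[OF GS_ropts[OF K assms(1)] assms(2)] by blast
    \<comment> \<open>Moving to \<open>K\<close> gives \<open>Rs (G +\<^sub>g T) < 0\<close>, while
      \<open>Rs (H +\<^sub>g T) > 0\<close>.\<close>
    then show False using ge Ls_gsum_ropt_left[OF K, of T] unfolding game_ge_def by force
  qed
  ultimately show "?pass \<and> ?left \<and> ?right" by blast
next
  assume *: "?pass \<and> ?left \<and> ?right"
  \<comment> \<open>Both stops are treated together because a move in \<open>X\<close> passes the
    turn. Only \<open>X\<close> shrinks; moves in \<open>G\<close> and \<open>H\<close> are covered
    by the assumed comparisons, which hold for all test games.\<close>
  have "Ls (H +\<^sub>g X) \<le> Ls (G +\<^sub>g X) \<and> Rs (H +\<^sub>g X) \<le> Rs (G +\<^sub>g X)" if "X \<in> GS" for X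
    using that
  proof (induction "size X" arbitrary: X rule: less_induct)
    case less
    have IH: "Ls (H +\<^sub>g K) \<le> Ls (G +\<^sub>g K) \<and> Rs (H +\<^sub>g K) \<le> Rs (G +\<^sub>g K)"
      if "K |\<in>| lopts X \<or> K |\<in>| ropts X" for K
      using that less size_lopts size_ropts GS_lopts GS_ropts by blast
    show ?case
      using Ls_gsum_mono_step[OF assms less.prems] Rs_gsum_mono_step[OF assms less.prems] * IH
      by blast
  qed
  then show "G \<succeq> H" unfolding game_ge_def by blast
qed

end
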